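(* Let $p,q,m',n'\ge1$, $m=m'+p-1$, $n=n'+q-1$, and let $A$ be an $m'\times n'$ integer matrix that is $(1,1)$-smooth. Then the problem Reconstruction$(A,p,q)$ admits a solution, i.e. there exists an $m\times n$ binary matrix $M$ with $R_{p,q}(M)=A$, if and only if the procedure RecSmooth$(A,p,q)$ does not return FAILURE.
   Context: A binary matrix has entries in $\{0,1\}$. $A$ is $(1,1)$-smooth if $A[i,j]+A[i+1,j+1]-A[i+1,j]-A[i,j+1]=0$ whenever $1\le i\le m'-1$, $1\le j\le n'-1$. The $(p,q)$-rectangular scan of an $m\times n$ matrix $M$ is the $(m-p+1)\times(n-q+1)$ matrix $R_{p,q}(M)[i,j]=\sum_{r=0}^{p-1}\sum_{c=0}^{q-1}M[i+r,j+c]$. Decomposition of $A$ (procedure Decompose). Let $k$ be the minimum entry of $A$ and $\rho_i=\min_j(A[i,j]-k)$. For each integer $0\le t\le k$ put $A_r^t[i,j]=\rho_i+t$ and $A_c^t[i,j]=A[i,j]-\rho_i-t$. (For $(1,1)$-smooth $A$, $A_r^t$ has constant rows, $A_c^t$ has constant columns, and $A_r^t+A_c^t=A$.) Vector $PEnt$ (Step 1 of procedure RecConstRows$(B,p,q)$, for an $m'\times n'$ integer matrix $B$ with constant rows). $PEnt$ has length $m$, initialized to $0$. For $i=1,\dots,m'-1$ in this order: (1.1) if $B[i,1]\le B[i+1,1]$, set $PEnt[i+p]=B[i+1,1]-B[i,1]+PEnt[i]$ (failure if this exceeds $q$); (1.2) if $B[i,1]>B[i+1,1]$ and $PEnt[i]\ge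 B[i,1]-B[i+1,1]$, set $PEnt[i+p]=B[i+1,1]-B[i,1]+PEnt[i]$; (1.3) if $B[i,1]>B[i+1,1]$ and $PEnt[i]<B[i,1]-B[i+1,1]$, let $h=B[i,1]-B[i+1,1]-PEnt[i]$ and add $h$ to $PEnt[i']$ for every $1\le i'\le i$ with $i'\equiv i\pmod p$ (failure if some such value exceeds $q$). The residual is $B[1,1]-PEnt[1]-\dots-PEnt[p]$. The procedure RecConstCols for matrices with constant columns is the transposed one (rows and columns exchanged, $p$ and $q$ exchanged, $m$ and $n$ exchanged). Procedure RecSmooth$(A,p,q)$. For $t=0,1,\dots,k$ in turn: Step 1.1: apply Step 1 of RecConstRows to $A_r^t$, obtaining the vector $PEnt_{row}$ of length $m$ and residual $k_{row}$; for $1\le i\le p$ let $PEnt_{\equiv p}[i]=\max\{PEnt_{row}[i'] : 1\le i'\le m,\ i'\equiv i \pmod p\}$. Step 1.2: apply Step 1 of RecConstCols to $A_c^t$, obtaining the vector $PEnt_{col}$ of length $n$ and residual $k_{col}$; for $1\le j\le q$ let $PEnt_{\equiv q}[j]=\max\{PEnt_{col}[j'] : 1\le j'\le n,\ j'\equiv j\pmod q\}$. Step 1.3: look for a $p\times q$ matrix $W$ with entries in the set of four symbols $\{P,Q,1,0\}$ such that (i) for each $1\le i\le p$ the number of entries $Q$ in row $i$ is $PEnt_{\equiv p}[i]$; (ii) for each $1\le j\le q$ the number of entries $P$ in column $j$ is $PEnt_{\equiv q}[j]$; (iii) the total number of entries $1$ is $k_{row}+k_{col}$. If such a $W$ exists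 for the current $t$ (and no failure occurred in Steps 1.1 and 1.2), the search stops successfully, and the procedure does not return FAILURE. It instead builds an $m\times n$ binary matrix as its output, as follows: among the first $q$ columns of row $i$ mark $PEnt_{row}[i]$ of the positions $(i,j)$ for which $W[i',j]=Q$ with $1\le i'\le p$, $i'\equiv i\pmod p$ (the first ones from the left), and extend these marks $(0,q)$-periodically along the row; symmetrically, among the first $p$ rows of column $j$ mark $PEnt_{col}[j]$ of the positions $(i,j)$ for which $W[i,j']=P$ with $1\le j'\le q$, $j'\equiv j\pmod q$, and extend these marks $(p,0)$-periodically along the column; mark also every position congruent modulo $(p,q)$ to an entry $1$ of $W$; marked positions get value $1$, all others $0$. If for no $t\in\{0,\dots,k\}$ such a $W$ is found (in particular if $k<0$), the procedure returns FAILURE. *)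

theory Defs
  imports "Jordan_Normal_Form.Matrix"
begin

text \<open>All indices are shifted to start at 0. The shift is the same for positions and for
  residue classes, so congruences modulo \<open>p\<close> and \<open>q\<close> are unaffected.\<close>

definition binary_mat :: "int mat \<Rightarrow> bool" where
  "binary_mat M \<longleftrightarrow> elements_mat M \<subseteq> {0, 1}"

definition smooth11 :: "int mat \<Rightarrow> bool" where
  "smooth11 A \<longleftrightarrow> (\<forall>i j. i + 1 < dim_row A \<longrightarrow> j + 1 < dim_col A \<longrightarrow>
     A $$ (i, j) + A $$ (i + 1, j + 1) - A $$ (i + 1, j) - A $$ (i, j + 1) = 0)"

text \<open>Meaningful for \<open>1 \<le> p \<le> dim_row M\<close> and \<open>1 \<le> q \<le> dim_col M\<close>.\<close>

definition rect_scan :: "nat \<Rightarrow> nat \<Rightarrow> int mat \<Rightarrow> int mat" where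
  "rect_scan p q M = mat (dim_row M - p + 1) (dim_col M - q + 1)
     (\<lambda>(i, j). \<Sum>r = 0..<p. \<Sum>c = 0..<q. M $$ (i + r, j + c))"

definition min_entry :: "int mat \<Rightarrow> int" where
  "min_entry A = Min (elements_mat A)"

definition rho :: "int mat \<Rightarrow> nat \<Rightarrow> int" where
  "rho A i = Min ((\<lambda>j. A $$ (i, j) - min_entry A) ` {0..<dim_col A})"

definition row_part :: "int mat \<Rightarrow> int \<Rightarrow> int mat" where
  "row_part A t = mat (dim_row A) (dim_col A) (\<lambda>(i, j). rho A i + t)"

definition col_part :: "int mat \<Rightarrow> int \<Rightarrow> int mat" where
  "col_part A t = mat (dim_row A) (dim_col A) (\<lambda>(i, j). A $$ (i, j) - rho A i - t)"

text \<open>One iteration of the loop computing the vector \<open>PEnt\<close>, here the list \<open>x\<close>; the result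
  \<open>None\<close> is a failure. In the last branch \<open>x ! (i + p)\<close> keeps its initial value 0.\<close>

definition pent_step :: "int mat \<Rightarrow> nat \<Rightarrow> nat \<Rightarrow> nat \<Rightarrow> int list \<Rightarrow> int list option" where
  "pent_step B p q i x =
     (if B $$ (i, 0) \<le> B $$ (i + 1, 0) then
        (let v = B $$ (i + 1, 0) - B $$ (i, 0) + x ! i
         in if v > int q then None else Some (x[i + p := v]))
      else if x ! i \<ge> B $$ (i, 0) - B $$ (i + 1, 0) then
        Some (x[i + p := B $$ (i + 1, 0) - B $$ (i, 0) + x ! i])
      else
        (let h = B $$ (i, 0) - B $$ (i + 1, 0) - x ! i;
             y = map (\<lambda>l. if l \<le> i \<and> l mod p = i mod p then x ! l + h else x ! l) [0..<length x]
         in if \<exists>l\<le>i. l mod p = i mod p \<and> y ! l > int q then None else Some y))"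

definition pent :: "int mat \<Rightarrow> nat \<Rightarrow> nat \<Rightarrow> int list option" where
  "pent B p q = fold (\<lambda>i s. Option.bind s (pent_step B p q i)) [0..<dim_row B - 1]
     (Some (replicate (dim_row B + p - 1) 0))"

definition rec_const_rows_step1 :: "int mat \<Rightarrow> nat \<Rightarrow> nat \<Rightarrow> (int list \<times> int) option" where
  "rec_const_rows_step1 B p q =
     map_option (\<lambda>x. (x, B $$ (0, 0) - (\<Sum>l = 0..<p. x ! l))) (pent B p q)"

definition rec_const_cols_step1 :: "int mat \<Rightarrow> nat \<Rightarrow> nat \<Rightarrow> (int list \<times> int) option" where
  "rec_const_cols_step1 B p q = rec_const_rows_step1 (transpose_mat B) q p"

definition class_max :: "nat \<Rightarrow> int list \<Rightarrow> nat \<Rightarrow> int" where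
  "class_max p x i = Max ((!) x ` {l. l < length x \<and> l mod p = i mod p})"

datatype symb = SymP | SymQ | SymOne | SymZero

definition admissible ::
  "nat \<Rightarrow> nat \<Rightarrow> int list \<Rightarrow> int list \<Rightarrow> int \<Rightarrow> symb mat \<Rightarrow> bool" where
  "admissible p q xr xc k W \<longleftrightarrow> W \<in> carrier_mat p q \<and>
     (\<forall>i<p. int (card {j. j < q \<and> W $$ (i, j) = SymQ}) = class_max p xr i) \<and>
     (\<forall>j<q. int (card {i. i < p \<and> W $$ (i, j) = SymP}) = class_max q xc j) \<and>
     int (card {(i, j). i < p \<and> j < q \<and> W $$ (i, j) = SymOne}) = k"

text \<open>A position is marked by its row iff its residue carries \<open>SymQ\<close> and fewer than \<open>xr ! i\<close>
  occurrences of \<open>SymQ\<close> precede it in that row of \<open>W\<close>; taking the column index modulo \<open>q\<close>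
  performs the \<open>(0,q)\<close>-periodic extension. Columns are symmetric, with the first occurrences
  taken from the top.\<close>

definition build :: "nat \<Rightarrow> nat \<Rightarrow> int list \<Rightarrow> int list \<Rightarrow> symb mat \<Rightarrow> int mat" where
  "build p q xr xc W = mat (length xr) (length xc) (\<lambda>(i, j).
     let a = i mod p; b = j mod q in
     if W $$ (a, b) = SymOne \<or>
        W $$ (a, b) = SymQ \<and> int (card {b'. b' < b \<and> W $$ (a, b') = SymQ}) < xr ! i \<or>
        W $$ (a, b) = SymP \<and> int (card {a'. a' < a \<and> W $$ (a', b) = SymP}) < xc ! j
     then 1 else 0)"

text \<open>The search for \<open>W\<close> does not prescribe which admissible matrix is found; \<open>SOME\<close> stands for an
  arbitrary one, and only the output matrix can depend on that choice.\<close>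

definition rec_smooth_try :: "int mat \<Rightarrow> nat \<Rightarrow> nat \<Rightarrow> int \<Rightarrow> int mat option" where
  "rec_smooth_try A p q t =
     (case (rec_const_rows_step1 (row_part A t) p q, rec_const_cols_step1 (col_part A t) p q) of
        (Some (xr, kr), Some (xc, kc)) \<Rightarrow>
          (if \<exists>W. admissible p q xr xc (kr + kc) W
           then Some (build p q xr xc (SOME W. admissible p q xr xc (kr + kc) W))
           else None)
      | _ \<Rightarrow> None)"

text \<open>The result \<open>None\<close> is FAILURE. The list \<open>[0..k]\<close> is empty when \<open>k < 0\<close>.\<close>

definition rec_smooth :: "int mat \<Rightarrow> nat \<Rightarrow> nat \<Rightarrow> int mat option" where
  "rec_smooth A p q =
     Option.bind (find (\<lambda>t. rec_smooth_try A p q t \<noteq> None) [0..min_entry A]) (rec_smooth_try A p q)"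

end

theory Submission
  imports Defs
begin

text \<open>
  Why success gives a solution. The loop that computes \<open>PEnt\<close> keeps
  \<open>x ! (l + p) - x ! l = B $$ (l + 1, 0) - B $$ (l, 0)\<close>. Hence sliding a window of length \<open>p\<close> over
  \<open>x\<close> by one step changes its sum exactly as \<open>B\<close> changes, and the window sums of \<open>x\<close> plus the
  residual reproduce \<open>B\<close>. In the output matrix every window sees, in each of its rows, one full
  period of the row marks, and similarly for the columns and for the constant ones. Its sum is
  therefore an entry of the row part plus an entry of the column part, that is, an entry of \<open>A\<close>
  (\<open>build_window_sum\<close>, \<open>rec_smooth_try_sound\<close>).

  Why a solution gives success. If the scan of \<open>M\<close> is smooth, then the mixed difference
  of \<open>M\<close> with steps \<open>p\<close> and \<open>q\<close> vanishes (\<open>smooth_scan_grid\<close>). On a class of positions modulo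
  \<open>(p, q)\<close> the matrix \<open>M\<close> is thus a function of the row plus a function of the column; since its values
  are 0 and 1, one of the two is constant. So each class is of type \<open>Q\<close> (constant rows, not
  constant), of type \<open>P\<close> (constant columns, not constant), or constant. Let \<open>y i\<close> be the number of
  type \<open>Q\<close> classes that are 1 in row \<open>i\<close>. The vector \<open>y\<close> satisfies the same recurrence as \<open>PEnt\<close>, and
  \<open>PEnt\<close> is the least nonnegative vector that does (\<open>pent_step_minimal\<close>); so no failure occurs, and
  \<open>y\<close> exceeds \<open>PEnt\<close> by some \<open>e a \<ge> 0\<close> that depends only on the residue \<open>a\<close> of the row. In the table of
  class types, turning \<open>e a\<close> symbols \<open>Q\<close> of row \<open>a\<close> into 1 and its superfluous symbols \<open>Q\<close> into 0, and doing
  the same for the columns, gives an admissible \<open>W\<close> (\<open>admissible_exists\<close>). The number of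
  ones comes out right because both counts are forced by \<open>A $$ (0, 0)\<close>. The whole argument is
  independent of the shift \<open>t\<close>, so already \<open>t = 0\<close> succeeds
  (\<open>rec_smooth_try_complete\<close>).
\<close>

section \<open>Sums over windows\<close>

lemma sum_window_shift:
  fixes g :: "nat \<Rightarrow> int"
  shows "(\<Sum>c = 0..<q. g (Suc j + c)) + g j = (\<Sum>c = 0..<q. g (j + c)) + g (j + q)"
  by (induction q) auto

lemma sum_window_periodic:
  fixes f :: "nat \<Rightarrow> int"
  shows "(\<Sum>c = 0..<q. f ((j + c) mod q)) = (\<Sum>c = 0..<q. f c)"
proof (induction j)
  case 0
  show ?case by (auto intro: sum.cong)
next
  case (Suc j)
  show ?case
    using sum_window_shift[of "\<lambda>l. f (l mod q)" j q] Suc by simp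
qed

lemma sum_window_telescope:
  fixes x b :: "nat \<Rightarrow> int"
  assumes "\<And>l. l < i \<Longrightarrow> x (l + p) - x l = b (Suc l) - b l"
  shows "(\<Sum>r = 0..<p. x (i + r)) = (\<Sum>r = 0..<p. x r) + b i - b 0"
  using assms
proof (induction i)
  case 0
  show ?case by simp
next
  case (Suc i)
  show ?case
    using sum_window_shift[of x i p] Suc.IH Suc.prems[of i] Suc.prems by force
qed

lemma eq_on_residue_class:
  fixes g :: "nat \<Rightarrow> int"
  assumes "\<And>j. j + q < n \<Longrightarrow> g (j + q) = g j" and "j < n"
  shows "g j = g (j mod q)"
  using assms(2)
proof (induction j rule: less_induct)
  case (less j)
  show ?case
  proof (cases "j < q \<or> q = 0")
    case True
    then show ?thesis by auto
  next
    case False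
    then have "g j = g (j - q)"
      using assms(1)[of "j - q"] less.prems by simp
    also have "\<dots> = g ((j - q) mod q)"
      using less False by simp
    also have "(j - q) mod q = j mod q"
      using False by (simp add: le_mod_geq)
    finally show ?thesis .
  qed
qed

text \<open>Both directions use this: a window meets every residue modulo \<open>q\<close> once in each of its rows and
  every residue modulo \<open>p\<close> once in each of its columns, so a summand that is periodic in one
  coordinate may be summed over the residues, wherever the window lies. It is applied to the
  output matrix and to an arbitrary solution.\<close>

lemma window_sum_separated:
  fixes F :: "nat \<Rightarrow> nat \<Rightarrow> int"
  assumes F: "\<And>i j. i < m \<Longrightarrow> j < n \<Longrightarrow>
      F i j = u i (j mod q) + v (i mod p) j + w (i mod p) (j mod q)"
    and "i + p \<le> m" and "j + q \<le> n"
  shows "(\<Sum>r = 0..<p. \<Sum>c = 0..<q. F (i + r) (j + c)) =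
    (\<Sum>r = 0..<p. \<Sum>b = 0..<q. u (i + r) b) + (\<Sum>c = 0..<q. \<Sum>a = 0..<p. v a (j + c))
    + (\<Sum>a = 0..<p. \<Sum>b = 0..<q. w a b)"
proof -
  have "(\<Sum>r = 0..<p. \<Sum>c = 0..<q. F (i + r) (j + c)) =
      (\<Sum>r = 0..<p. \<Sum>c = 0..<q. u (i + r) ((j + c) mod q) + v ((i + r) mod p) (j + c)
        + w ((i + r) mod p) ((j + c) mod q))"
    using assms by (intro sum.cong refl) simp
  also have "\<dots> = (\<Sum>r = 0..<p. \<Sum>c = 0..<q. u (i + r) ((j + c) mod q))
      + (\<Sum>r = 0..<p. \<Sum>c = 0..<q. v ((i + r) mod p) (j + c))
      + (\<Sum>r = 0..<p. \<Sum>c = 0..<q. w ((i + r) mod p) ((j + c) mod q))"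
    by (simp add: sum.distrib)
  also have "(\<Sum>r = 0..<p. \<Sum>c = 0..<q. u (i + r) ((j + c) mod q)) =
      (\<Sum>r = 0..<p. \<Sum>b = 0..<q. u (i + r) b)"
    by (simp only: sum_window_periodic)
  also have "(\<Sum>r = 0..<p. \<Sum>c = 0..<q. v ((i + r) mod p) (j + c)) =
      (\<Sum>c = 0..<q. \<Sum>r = 0..<p. v ((i + r) mod p) (j + c))"
    by (rule sum.swap)
  also have "\<dots> = (\<Sum>c = 0..<q. \<Sum>a = 0..<p. v a (j + c))"
    by (simp only: sum_window_periodic[of "\<lambda>a. v a _"])
  also have "(\<Sum>r = 0..<p. \<Sum>c = 0..<q. w ((i + r) mod p) ((j + c) mod q)) =
      (\<Sum>r = 0..<p. \<Sum>b = 0..<q. w ((i + r) mod p) b)"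
    by (simp only: sum_window_periodic)
  also have "\<dots> = (\<Sum>a = 0..<p. \<Sum>b = 0..<q. w a b)"
    by (rule sum_window_periodic[of "\<lambda>a. \<Sum>b = 0..<q. w a b"])
  finally show ?thesis .
qed

section \<open>The vector computed from a matrix with constant rows\<close>

text \<open>The state of \<open>x\<close> after the iterations \<open>0, \<dots>, s - 1\<close>. The last conjunct matters because the
  third branch of the loop relies on \<open>x ! (s + p)\<close> still having its initial value.\<close>

definition partial_pent :: "int mat \<Rightarrow> nat \<Rightarrow> nat \<Rightarrow> int list \<Rightarrow> bool" where
  "partial_pent B p s x \<longleftrightarrow> length x = dim_row B + p - 1 \<and>
     (\<forall>l < length x. 0 \<le> x ! l) \<and>
     (\<forall>l < s. x ! (l + p) - x ! l = B $$ (Suc l, 0) - B $$ (l, 0)) \<and>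
     (\<forall>l < length x. s + p \<le> l \<longrightarrow> x ! l = 0)"

lemma residue_gap:
  fixes l i p :: nat
  assumes "l mod p = i mod p" and "l < i"
  shows "l + p \<le> i"
proof -
  have "p dvd i - l"
    using assms by (metis less_imp_le mod_eq_dvd_iff_nat)
  then show ?thesis
    using assms(2) by (auto dest: dvd_imp_le)
qed

lemma pent_step_partial:
  assumes x: "partial_pent B p i x" and i: "Suc i < dim_row B" and "p \<ge> 1"
    and step: "pent_step B p q i x = Some x'"
  shows "partial_pent B p (Suc i) x'"
proof -
  define d where "d = B $$ (Suc i, 0) - B $$ (i, 0)"
  have len: "length x = dim_row B + p - 1" and ip: "i + p < length x"
    and nonneg: "\<And>l. l < length x \<Longrightarrow> 0 \<le> x ! l"
    and diff: "\<And>l. l < i \<Longrightarrow> x ! (l + p) - x ! l = B $$ (Suc l, 0) - B $$ (l, 0)"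
    and zero: "\<And>l. l < length x \<Longrightarrow> i + p \<le> l \<Longrightarrow> x ! l = 0"
    using x i \<open>p \<ge> 1\<close> by (auto simp: partial_pent_def)
  show ?thesis
  proof (cases "0 \<le> d + x ! i")
    case True
    have "x' = x[i + p := d + x ! i]"
      using step True unfolding pent_step_def d_def Let_def
      by (auto split: if_splits)
    moreover have "x[i + p := d + x ! i] ! (l + p) - x[i + p := d + x ! i] ! l
        = B $$ (Suc l, 0) - B $$ (l, 0)" if "l < Suc i" for l
      using that diff[of l] ip \<open>p \<ge> 1\<close> by (cases "l = i") (auto simp: nth_list_update d_def)
    ultimately show ?thesis
      using len nonneg zero True ip by (auto simp: partial_pent_def nth_list_update)
  next
    \<comment> \<open>The whole class of \<open>i\<close> up to \<open>i\<close> is raised by \<open>h\<close>, so old differences survive, and the new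
      difference is right because the entry at \<open>i + p\<close> is 0 and the one at \<open>i\<close> becomes \<open>- d\<close>.\<close>
    case False
    define h where "h = - d - x ! i"
    have h: "h > 0" using False by (simp add: h_def)
    have "d < 0"
      using False nonneg[of i] ip by auto
    then have x': "x' = map (\<lambda>l. if l \<le> i \<and> l mod p = i mod p then x ! l + h else x ! l)
        [0..<length x]"
      using step False unfolding pent_step_def d_def h_def Let_def
      by (auto split: if_splits)
    have nth: "x' ! l = (if l \<le> i \<and> l mod p = i mod p then x ! l + h else x ! l)"
      if "l < length x" for l
      using that by (simp add: x')
    have "x' ! (l + p) - x' ! l = B $$ (Suc l, 0) - B $$ (l, 0)" if "l < Suc i" for l
    proof (cases "l = i")
      case True
      then show ?thesis
        using nth[of i] nth[of "i + p"] ip zero[of "i + p"] \<open>p \<ge> 1\<close> by (simp add: h_def d_def)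
    next
      case False
      then have "l < i" using that by simp
      then have "l + p \<le> i" if "l mod p = i mod p"
        using residue_gap that by blast
      then show ?thesis
        using nth[of l] nth[of "l + p"] ip diff[OF \<open>l < i\<close>] \<open>l < i\<close> by auto
    qed
    moreover have "length x' = length x" by (simp add: x')
    ultimately show ?thesis
      using len nonneg zero h ip nth by (auto simp: partial_pent_def)
  qed
qed

text \<open>Along a residue class, as far as it is computed, \<open>x\<close> differs from \<open>y\<close> by a constant, since both
  satisfy the recurrence. In the third branch, raising a class by \<open>h\<close> makes the entry at \<open>i\<close> equal to \<open>- d\<close>, where \<open>d\<close> is the next difference; every
  nonnegative \<open>y\<close> has \<open>y i \<ge> - d\<close>, as otherwise \<open>y (i + p)\<close> would be negative. So \<open>y\<close> still
  dominates at \<open>i\<close>, hence on the whole class. A bound \<open>q\<close> on \<open>y\<close> then rules out failure.\<close>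

lemma pent_step_minimal:
  assumes x: "partial_pent B p i x" and i: "Suc i < dim_row B" and "p \<ge> 1"
    and y_bounds: "\<And>l. l < length x \<Longrightarrow> 0 \<le> y l \<and> y l \<le> int q"
    and y_diff: "\<And>l. Suc l < dim_row B \<Longrightarrow> y (l + p) - y l = B $$ (Suc l, 0) - B $$ (l, 0)"
    and x_le: "\<And>l. l < length x \<Longrightarrow> x ! l \<le> y l"
  shows "\<exists>x'. pent_step B p q i x = Some x' \<and> length x' = length x \<and>
    (\<forall>l < length x. x' ! l \<le> y l)"
proof -
  define d where "d = B $$ (Suc i, 0) - B $$ (i, 0)"
  have len: "length x = dim_row B + p - 1" and ip: "i + p < length x"
    and nonneg: "\<And>l. l < length x \<Longrightarrow> 0 \<le> x ! l"
    and diff: "\<And>l. l < i \<Longrightarrow> x ! (l + p) - x ! l = B $$ (Suc l, 0) - B $$ (l, 0)"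
    using x i \<open>p \<ge> 1\<close> by (auto simp: partial_pent_def)
  have yip: "y (i + p) = y i + d"
    using y_diff[OF i] by (simp add: d_def)
  show ?thesis
  proof (cases "0 \<le> d + x ! i")
    case True
    have le: "d + x ! i \<le> y (i + p)" using x_le[of i] yip ip by simp
    then have "d + x ! i \<le> int q" using y_bounds[OF ip] by linarith
    then have "pent_step B p q i x = Some (x[i + p := d + x ! i])"
      using True unfolding pent_step_def d_def Let_def by auto
    then show ?thesis
      using le x_le ip by (auto simp: nth_list_update)
  next
    case False
    define h where "h = B $$ (i, 0) - B $$ (i + 1, 0) - x ! i"
    have h: "h = - d - x ! i" by (simp add: h_def d_def)
    define x' where "x' = map (\<lambda>l. if l \<le> i \<and> l mod p = i mod p then x ! l + h else x ! l)
        [0..<length x]"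
    have nth: "x' ! l = (if l \<le> i \<and> l mod p = i mod p then x ! l + h else x ! l)"
      if "l < length x" for l
      using that by (simp add: x'_def)
    have const: "y l - x ! l = y i - x ! i" if "l \<le> i" "l mod p = i mod p" for l
    proof -
      have "y (k + p) - x ! (k + p) = y k - x ! k" if "k + p < Suc i" for k
      proof -
        have "k < i" using that \<open>p \<ge> 1\<close> by simp
        then show ?thesis using diff[of k] y_diff[of k] i by simp
      qed
      then have "y k - x ! k = y (k mod p) - x ! (k mod p)" if "k \<le> i" for k
        using eq_on_residue_class[of p "Suc i" "\<lambda>l. y l - x ! l" k] that by simp
      from this[of l] this[of i] that show ?thesis by simp
    qed
    have le: "x' ! l \<le> y l" if "l < length x" for l
    proof (cases "l \<le> i \<and> l mod p = i mod p")
      case True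
      then show ?thesis
        using const[of l] nth[OF that] yip y_bounds[OF ip] by (simp add: h)
    next
      case False
      then have "x' ! l = x ! l" using nth[OF that] by auto
      then show ?thesis using x_le[OF that] by simp
    qed
    have "d < 0"
      using False nonneg[of i] ip by auto
    have "\<not> (\<exists>l\<le>i. l mod p = i mod p \<and> x' ! l > int q)"
      using le y_bounds ip by (meson add_lessD1 le_less_trans not_le order_trans)
    then have "pent_step B p q i x = Some x'"
      using False \<open>d < 0\<close> unfolding pent_step_def Let_def h_def[symmetric] x'_def[symmetric]
      by (auto simp: d_def)
    then show ?thesis
      using le by (auto simp: x'_def)
  qed
qed

lemma pent_fold_partial:
  assumes "s < dim_row B" and "p \<ge> 1"
    and "fold (\<lambda>i s'. Option.bind s' (pent_step B p q i)) [0..<s]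
      (Some (replicate (dim_row B + p - 1) 0)) = Some x"
  shows "partial_pent B p s x"
  using assms
proof (induction s arbitrary: x)
  case 0
  then show ?case by (auto simp: partial_pent_def)
next
  case (Suc s)
  then show ?case
    by (auto simp: bind_eq_Some_conv intro: pent_step_partial)
qed

lemma pent_fold_minimal:
  assumes "s < dim_row B" and "p \<ge> 1"
    and y_bounds: "\<And>l. l < dim_row B + p - 1 \<Longrightarrow> 0 \<le> y l \<and> y l \<le> int q"
    and y_diff: "\<And>l. Suc l < dim_row B \<Longrightarrow> y (l + p) - y l = B $$ (Suc l, 0) - B $$ (l, 0)"
  shows "\<exists>x. fold (\<lambda>i s'. Option.bind s' (pent_step B p q i)) [0..<s]
      (Some (replicate (dim_row B + p - 1) 0)) = Some x \<and>
      (\<forall>l < dim_row B + p - 1. x ! l \<le> y l)"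
  using assms(1)
proof (induction s)
  case 0
  then show ?case using y_bounds by auto
next
  case (Suc s)
  then obtain x where x: "fold (\<lambda>i s'. Option.bind s' (pent_step B p q i)) [0..<s]
      (Some (replicate (dim_row B + p - 1) 0)) = Some x"
      "\<forall>l < dim_row B + p - 1. x ! l \<le> y l"
    by auto
  have part: "partial_pent B p s x"
    using pent_fold_partial[OF _ assms(2) x(1)] Suc.prems by simp
  then have "length x = dim_row B + p - 1" by (simp add: partial_pent_def)
  with pent_step_minimal[OF part Suc.prems assms(2), of y q] x y_bounds y_diff
  show ?case by auto
qed

lemma rec_const_rows_step1_sound:
  assumes "rec_const_rows_step1 B p q = Some (x, k)" and "p \<ge> 1" and "dim_row B \<ge> 1"
  shows "length x = dim_row B + p - 1" and "\<And>l. l < length x \<Longrightarrow> 0 \<le> x ! l"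
    and "\<And>i. i < dim_row B \<Longrightarrow> (\<Sum>r = 0..<p. x ! (i + r)) + k = B $$ (i, 0)"
proof -
  have "pent B p q = Some x" and k: "k = B $$ (0, 0) - (\<Sum>l = 0..<p. x ! l)"
    using assms(1) by (auto simp: rec_const_rows_step1_def)
  then have part: "partial_pent B p (dim_row B - 1) x"
    unfolding pent_def using assms by (intro pent_fold_partial) auto
  then show "length x = dim_row B + p - 1" and "\<And>l. l < length x \<Longrightarrow> 0 \<le> x ! l"
    by (auto simp: partial_pent_def)
  show "(\<Sum>r = 0..<p. x ! (i + r)) + k = B $$ (i, 0)" if "i < dim_row B" for i
    using sum_window_telescope[of i "(!) x" p "\<lambda>i. B $$ (i, 0)"] part that k
    by (auto simp: partial_pent_def)
qed

text \<open>The excess \<open>e\<close> of \<open>y\<close> over the computed vector is a function on residue classes because both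
  satisfy the same recurrence. The constant \<open>c\<close> lets the window sums of \<open>y\<close> agree with \<open>B\<close> only up
  to a shift, which the residual absorbs.\<close>

lemma rec_const_rows_step1_complete:
  assumes "p \<ge> 1" and "dim_row B \<ge> 1"
    and y_bounds: "\<And>l. l < dim_row B + p - 1 \<Longrightarrow> 0 \<le> y l \<and> y l \<le> int q"
    and y_sum: "\<And>i. i < dim_row B \<Longrightarrow> (\<Sum>r = 0..<p. y (i + r)) = B $$ (i, 0) + c"
  shows "\<exists>x k e. rec_const_rows_step1 B p q = Some (x, k) \<and> (\<forall>a. 0 \<le> e a) \<and>
    (\<forall>l < dim_row B + p - 1. y l = x ! l + e (l mod p)) \<and> k + c = (\<Sum>a = 0..<p. e a)"
proof -
  have y_diff: "y (l + p) - y l = B $$ (Suc l, 0) - B $$ (l, 0)" if "Suc l < dim_row B" for l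
    using sum_window_shift[of y l p] y_sum[of l] y_sum[of "Suc l"] that by simp
  obtain x where x: "pent B p q = Some x"
    and x_le: "\<And>l. l < dim_row B + p - 1 \<Longrightarrow> x ! l \<le> y l"
    unfolding pent_def
    using pent_fold_minimal[of "dim_row B - 1" B p y q] assms y_diff by auto
  define k where "k = B $$ (0, 0) - (\<Sum>l = 0..<p. x ! l)"
  define e where "e a = (if a < p then y a - x ! a else 0)" for a
  have step: "rec_const_rows_step1 B p q = Some (x, k)"
    using x by (simp add: rec_const_rows_step1_def k_def)
  have part: "partial_pent B p (dim_row B - 1) x"
    using x unfolding pent_def using assms by (intro pent_fold_partial) auto
  have "y l = x ! l + e (l mod p)" if "l < dim_row B + p - 1" for l
  proof -
    have "y (j + p) - x ! (j + p) = y j - x ! j" if "j + p < dim_row B + p - 1" for j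
    proof -
      have "j < dim_row B - 1" using that by simp
      then have "x ! (j + p) - x ! j = B $$ (Suc j, 0) - B $$ (j, 0)"
        using part by (auto simp: partial_pent_def)
      moreover have "y (j + p) - y j = B $$ (Suc j, 0) - B $$ (j, 0)"
        using \<open>j < dim_row B - 1\<close> by (intro y_diff) simp
      ultimately show ?thesis by linarith
    qed
    then have "y l - x ! l = y (l mod p) - x ! (l mod p)"
      using eq_on_residue_class[of p _ "\<lambda>l. y l - x ! l" l] that by blast
    then show ?thesis using \<open>p \<ge> 1\<close> by (simp add: e_def)
  qed
  moreover have "0 \<le> e a" for a
    using x_le[of a] \<open>dim_row B \<ge> 1\<close> by (simp add: e_def)
  moreover have "k + c = (\<Sum>a = 0..<p. e a)"
    using y_sum[of 0] \<open>dim_row B \<ge> 1\<close> by (simp add: k_def e_def sum_subtractf)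
  ultimately show ?thesis using step by blast
qed

lemma class_max_ge:
  assumes "l < length x" and "l mod p = i mod p"
  shows "x ! l \<le> class_max p x i"
  unfolding class_max_def using assms by (intro Max_ge) auto

lemma class_max_attained:
  assumes "i < length x"
  obtains l where "l < length x" and "l mod p = i mod p" and "class_max p x i = x ! l"
proof -
  have "class_max p x i \<in> (!) x ` {l. l < length x \<and> l mod p = i mod p}"
    unfolding class_max_def using assms by (intro Max_in) auto
  then show ?thesis using that by auto
qed

section \<open>Counting marks\<close>

lemma card_first_elements:
  fixes S :: "nat set"
  assumes "finite S" and "k \<le> card S"
  shows "card {b \<in> S. card {b' \<in> S. b' < b} < k} = k"
proof -
  \<comment> \<open>The rank maps \<open>S\<close> bijectively onto an initial segment of the natural numbers.\<close>
  define rank where "rank b = card {b' \<in> S. b' < b}" for b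
  have mono: "rank b < rank c" if "b \<in> S" "b < c" for b c
    unfolding rank_def using that assms(1) by (intro psubset_card_mono) auto
  have inj: "inj_on rank S"
    using mono by (metis inj_onI less_irrefl linorder_neqE_nat)
  have "rank b < card S" if "b \<in> S" for b
    unfolding rank_def using that assms(1) by (intro psubset_card_mono) auto
  then have image: "rank ` S = {..<card S}"
    using card_image[OF inj] by (intro card_subset_eq) auto
  have "rank ` {b \<in> S. rank b < k} = rank ` S \<inter> {..<k}"
    by auto
  then have "rank ` {b \<in> S. rank b < k} = {..<k}"
    using assms(2) unfolding image by auto
  moreover have "inj_on rank {b \<in> S. rank b < k}"
    using inj by (rule inj_on_subset) auto
  ultimately have "card {b \<in> S. rank b < k} = card {..<k}"
    using card_image by fastforce
  then show ?thesis by (simp add: rank_def)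
qed

lemma sum_marks:
  fixes q :: nat
  assumes "0 \<le> k" and "k \<le> int (card {b. b < q \<and> P b})"
  shows "(\<Sum>b = 0..<q. of_bool (P b \<and> int (card {b'. b' < b \<and> P b'}) < k)) = k"
proof -
  define S where "S = {b. b < q \<and> P b}"
  have rank: "{b' \<in> S. b' < b} = {b'. b' < b \<and> P b'}" if "b < q" for b
    using that by (auto simp: S_def intro: less_trans)
  have "{0..<q} \<inter> {b. P b \<and> int (card {b'. b' < b \<and> P b'}) < k}
      = {b \<in> S. card {b' \<in> S. b' < b} < nat k}"
    using rank \<open>0 \<le> k\<close> by (auto simp: S_def zless_nat_eq_int_zless)
  moreover have "card {b \<in> S. card {b' \<in> S. b' < b} < nat k} = nat k"
    using assms by (intro card_first_elements) (auto simp: S_def)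
  ultimately show ?thesis
    using \<open>0 \<le> k\<close> by (simp add: sum_of_bool_eq)
qed

lemma sum_of_bool_pairs:
  fixes p q :: nat
  shows "(\<Sum>a = 0..<p. \<Sum>b = 0..<q. of_bool (P a b)) = int (card {(a, b). a < p \<and> b < q \<and> P a b})"
proof -
  have "{(a, b). a < p \<and> b < q \<and> P a b} = (SIGMA a:{0..<p}. {0..<q} \<inter> {b. P a b})"
    by fastforce
  then show ?thesis by simp
qed

lemma disjoint_subsets_with_cards:
  assumes "finite S" and "0 \<le> u" and "0 \<le> v" and "u + v \<le> int (card S)"
  shows "\<exists>U V. U \<subseteq> S \<and> V \<subseteq> S \<and> U \<inter> V = {} \<and> int (card U) = u \<and> int (card V) = v"
proof -
  have "nat u \<le> card S" using assms by linarith
  then obtain U where U: "U \<subseteq> S" "card U = nat u"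
    by (rule obtain_subset_with_card_n)
  have "nat v \<le> card (S - U)"
    using assms U by (simp add: card_Diff_subset finite_subset)
  then obtain V where "V \<subseteq> S - U" "card V = nat v"
    by (rule obtain_subset_with_card_n)
  with U assms show ?thesis by (intro exI[of _ U] exI[of _ V]) auto
qed

lemma disjoint_subset_families:
  assumes "\<And>a. a < p \<Longrightarrow> finite (S a)"
    and "\<And>a. a < p \<Longrightarrow> 0 \<le> u a \<and> 0 \<le> v a \<and> u a + v a \<le> int (card (S a))"
  obtains U V where "\<And>a. a < p \<Longrightarrow> U a \<subseteq> S a" and "\<And>a. a < p \<Longrightarrow> V a \<subseteq> S a"
    and "\<And>a. a < p \<Longrightarrow> U a \<inter> V a = {}"
    and "\<And>a. a < p \<Longrightarrow> int (card (U a)) = u a" and "\<And>a. a < p \<Longrightarrow> int (card (V a)) = v a"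
proof -
  define R where "R a Z \<longleftrightarrow> fst Z \<subseteq> S a \<and> snd Z \<subseteq> S a \<and> fst Z \<inter> snd Z = {} \<and>
    int (card (fst Z)) = u a \<and> int (card (snd Z)) = v a" for a Z
  have "\<exists>Z. R a Z" if a: "a < p" for a
  proof -
    obtain U V where "U \<subseteq> S a \<and> V \<subseteq> S a \<and> U \<inter> V = {} \<and> int (card U) = u a \<and> int (card V) = v a"
      using disjoint_subsets_with_cards[of "S a" "u a" "v a"] assms(1)[OF a] assms(2)[OF a]
      by blast
    then have "R a (U, V)" by (simp add: R_def)
    then show ?thesis ..
  qed
  then obtain Z where "\<And>a. a < p \<Longrightarrow> R a (Z a)" by metis
  then show ?thesis
    by (intro that[of "\<lambda>a. fst (Z a)" "\<lambda>a. snd (Z a)"]) (simp_all add: R_def)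
qed

section \<open>The output is a solution\<close>

text \<open>The class maximum in the definition of admissibility guarantees that row \<open>i\<close> finds at least
  \<open>xr ! i\<close> symbols \<open>SymQ\<close> to mark, and column \<open>j\<close> at least \<open>xc ! j\<close> symbols \<open>SymP\<close>.\<close>

lemma build_window_sum:
  assumes W: "admissible p q xr xc k W" and "p \<ge> 1" and "q \<ge> 1"
    and xr: "\<And>i. i < length xr \<Longrightarrow> 0 \<le> xr ! i" and xc: "\<And>j. j < length xc \<Longrightarrow> 0 \<le> xc ! j"
    and "i + p \<le> length xr" and "j + q \<le> length xc"
  shows "(\<Sum>r = 0..<p. \<Sum>c = 0..<q. build p q xr xc W $$ (i + r, j + c)) =
    (\<Sum>r = 0..<p. xr ! (i + r)) + (\<Sum>c = 0..<q. xc ! (j + c)) + k"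
proof -
  define u :: "nat \<Rightarrow> nat \<Rightarrow> int" where "u i b = of_bool (W $$ (i mod p, b) = SymQ \<and>
    int (card {b'. b' < b \<and> W $$ (i mod p, b') = SymQ}) < xr ! i)" for i b
  define v :: "nat \<Rightarrow> nat \<Rightarrow> int" where "v a j = of_bool (W $$ (a, j mod q) = SymP \<and>
    int (card {a'. a' < a \<and> W $$ (a', j mod q) = SymP}) < xc ! j)" for a j
  define w :: "nat \<Rightarrow> nat \<Rightarrow> int" where "w a b = of_bool (W $$ (a, b) = SymOne)" for a b
  have "build p q xr xc W $$ (i, j) = u i (j mod q) + v (i mod p) j + w (i mod p) (j mod q)"
    if "i < length xr" "j < length xc" for i j
    using that by (cases "W $$ (i mod p, j mod q)")
      (auto simp: build_def u_def v_def w_def Let_def)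
  then have "(\<Sum>r = 0..<p. \<Sum>c = 0..<q. build p q xr xc W $$ (i + r, j + c)) =
    (\<Sum>r = 0..<p. \<Sum>b = 0..<q. u (i + r) b) + (\<Sum>c = 0..<q. \<Sum>a = 0..<p. v a (j + c))
    + (\<Sum>a = 0..<p. \<Sum>b = 0..<q. w a b)"
    using assms by (intro window_sum_separated)
  moreover have "(\<Sum>b = 0..<q. u l b) = xr ! l" if "l < length xr" for l
  proof -
    have "xr ! l \<le> int (card {b. b < q \<and> W $$ (l mod p, b) = SymQ})"
      using W that \<open>p \<ge> 1\<close> class_max_ge[of l xr p "l mod p"] by (simp add: admissible_def)
    then show ?thesis unfolding u_def using xr that by (intro sum_marks) auto
  qed
  moreover have "(\<Sum>a = 0..<p. v a l) = xc ! l" if "l < length xc" for l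
  proof -
    have "xc ! l \<le> int (card {a. a < p \<and> W $$ (a, l mod q) = SymP})"
      using W that \<open>q \<ge> 1\<close> class_max_ge[of l xc q "l mod q"] by (simp add: admissible_def)
    then show ?thesis unfolding v_def using xc that by (intro sum_marks) auto
  qed
  moreover have "(\<Sum>a = 0..<p. \<Sum>b = 0..<q. w a b) = k"
    using W unfolding w_def sum_of_bool_pairs by (simp add: admissible_def)
  ultimately show ?thesis using assms by simp
qed

lemma smooth11_step:
  assumes "smooth11 A" and "Suc i < dim_row A" and "Suc j < dim_col A"
  shows "A $$ (Suc i, Suc j) - A $$ (i, Suc j) = A $$ (Suc i, j) - A $$ (i, j)"
proof -
  have "A $$ (i, j) + A $$ (i + 1, j + 1) - A $$ (i + 1, j) - A $$ (i, j + 1) = 0"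
    using assms unfolding smooth11_def by (metis Suc_eq_plus1)
  then show ?thesis by simp
qed

lemma smooth11_entry:
  assumes "smooth11 A" and "i < dim_row A" and "j < dim_col A"
  shows "A $$ (i, j) = A $$ (i, 0) + A $$ (0, j) - A $$ (0, 0)"
proof -
  have step: "A $$ (Suc i, j) - A $$ (i, j) = A $$ (Suc i, 0) - A $$ (i, 0)"
    if "Suc i < dim_row A" "j < dim_col A" for i j
    using that(2)
  proof (induction j)
    case (Suc j)
    then show ?case
      using smooth11_step[OF assms(1) that(1), of j] by simp
  qed simp
  show ?thesis
    using assms(2)
  proof (induction i)
    case (Suc i)
    then show ?case using step[of i j] assms(3) by simp
  qed simp
qed

text \<open>All rows of a smooth matrix attain their minimum at the same columns, so row minima differ
  by the same amounts as the entries of the first column.\<close>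

lemma rho_smooth:
  assumes "smooth11 A" and "i < dim_row A" and "0 < dim_col A"
  shows "rho A i = rho A 0 + A $$ (i, 0) - A $$ (0, 0)"
proof -
  have "(\<lambda>j. A $$ (i, j) - min_entry A) ` {0..<dim_col A} =
      (\<lambda>j. (A $$ (0, j) - min_entry A) + (A $$ (i, 0) - A $$ (0, 0))) ` {0..<dim_col A}"
  proof (intro image_cong refl)
    fix j assume "j \<in> {0..<dim_col A}"
    then show "A $$ (i, j) - min_entry A
        = (A $$ (0, j) - min_entry A) + (A $$ (i, 0) - A $$ (0, 0))"
      using smooth11_entry[of A i j] assms by simp
  qed
  then show ?thesis
    unfolding rho_def using assms(3)
      Min_add_commute[of "{0..<dim_col A}" "\<lambda>j. A $$ (0, j) - min_entry A"] by simp
qed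

lemma binary_build: "binary_mat (build p q xr xc W)"
  by (auto simp: binary_mat_def elements_mat_def build_def Let_def)

lemma rec_smooth_try_sound:
  assumes "p \<ge> 1" and "q \<ge> 1" and "m' \<ge> 1" and "n' \<ge> 1"
    and A: "A \<in> carrier_mat m' n'" and "smooth11 A"
    and M_eq: "rec_smooth_try A p q t = Some M"
  shows "M \<in> carrier_mat (m' + p - 1) (n' + q - 1)" and "binary_mat M"
    and "rect_scan p q M = A"
proof -
  obtain xr kr xc kc where
    row: "rec_const_rows_step1 (row_part A t) p q = Some (xr, kr)" and
    col: "rec_const_rows_step1 (transpose_mat (col_part A t)) q p = Some (xc, kc)" and
    ex: "\<exists>W. admissible p q xr xc (kr + kc) W" and
    M_def: "M = build p q xr xc (SOME W. admissible p q xr xc (kr + kc) W)"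
    using M_eq by (auto simp: rec_smooth_try_def rec_const_cols_step1_def
        split: option.splits if_splits) blast
  obtain W where W: "admissible p q xr xc (kr + kc) W" and M: "M = build p q xr xc W"
    using someI_ex[OF ex] M_def by blast
  have dims: "dim_row (row_part A t) = m'" "dim_row (transpose_mat (col_part A t)) = n'"
    using A by (auto simp: row_part_def col_part_def)
  note r = rec_const_rows_step1_sound[OF row \<open>p \<ge> 1\<close>, unfolded dims, OF \<open>m' \<ge> 1\<close>]
  note c = rec_const_rows_step1_sound[OF col \<open>q \<ge> 1\<close>, unfolded dims, OF \<open>n' \<ge> 1\<close>]
  show carrier: "M \<in> carrier_mat (m' + p - 1) (n' + q - 1)"
    using r(1) c(1) by (simp add: M build_def)
  show "binary_mat M" by (simp add: M binary_build)
  show "rect_scan p q M = A"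
  proof (rule eq_matI)
    fix i j assume "i < dim_row A" "j < dim_col A"
    then have ij: "i < m'" "j < n'" using A by auto
    have "rect_scan p q M $$ (i, j) = (\<Sum>r = 0..<p. \<Sum>c = 0..<q. M $$ (i + r, j + c))"
      using carrier ij assms by (auto simp: rect_scan_def)
    also have "\<dots> = (\<Sum>r = 0..<p. xr ! (i + r)) + (\<Sum>c = 0..<q. xc ! (j + c)) + (kr + kc)"
      unfolding M using W r(1,2) c(1,2) ij assms by (intro build_window_sum) auto
    also have "\<dots> = (rho A i + t) + (A $$ (0, j) - rho A 0 - t)"
      using r(3)[OF ij(1)] c(3)[OF ij(2)] A ij by (simp add: row_part_def col_part_def)
    also have "\<dots> = A $$ (i, j)"
      using rho_smooth[of A i] smooth11_entry[of A i j] A ij \<open>smooth11 A\<close> by simp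
    finally show "rect_scan p q M $$ (i, j) = A $$ (i, j)" .
  qed (use carrier A assms in \<open>auto simp: rect_scan_def\<close>)
qed

section \<open>Every solution yields an admissible matrix\<close>

text \<open>Moving the window one step changes its sum by the difference of the lines that enter and leave.
  Doing so in both directions turns the mixed difference of the scan into the mixed
  difference of \<open>M\<close> with steps \<open>p\<close> and \<open>q\<close>, which therefore vanishes and propagates to the
  representatives of the residue classes.\<close>

lemma smooth_scan_grid:
  assumes M: "M \<in> carrier_mat m n" and A: "rect_scan p q M = A" and "smooth11 A"
    and "p \<le> m" and "q \<le> n" and ij: "i < m" "j < n"
  shows "M $$ (i, j) = M $$ (i, j mod q) + M $$ (i mod p, j) - M $$ (i mod p, j mod q)"
proof -
  have chi: "M $$ (i + p, j + q) - M $$ (i, j + q) = M $$ (i + p, j) - M $$ (i, j)"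
    if "i + p < m" "j + q < n" for i j
  proof -
    define D where "D j = (\<Sum>r = 0..<p. M $$ (Suc i + r, j)) - (\<Sum>r = 0..<p. M $$ (i + r, j))" for j
    have D: "D j = M $$ (i + p, j) - M $$ (i, j)" for j
      using sum_window_shift[of "\<lambda>l. M $$ (l, j)" i p] by (simp add: D_def)
    have row_diff: "A $$ (Suc i, j) - A $$ (i, j) = (\<Sum>c = 0..<q. D (j + c))" if "j + q \<le> n" for j
    proof -
      have scan: "A $$ (i, j) = (\<Sum>c = 0..<q. \<Sum>r = 0..<p. M $$ (i + r, j + c))"
        if "i + p \<le> m" for i
      proof -
        have "A $$ (i, j) = (\<Sum>r = 0..<p. \<Sum>c = 0..<q. M $$ (i + r, j + c))"
          using that \<open>j + q \<le> n\<close> M unfolding A[symmetric] by (simp add: rect_scan_def)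
        then show ?thesis by (simp only: sum.swap[of _ "{0..<p}"])
      qed
      show ?thesis
        using scan[of i] scan[of "Suc i"] \<open>i + p < m\<close> by (simp add: D_def sum_subtractf)
    qed
    have "dim_row A = m - p + 1" "dim_col A = n - q + 1"
      using M unfolding A[symmetric] by (auto simp: rect_scan_def)
    then have "A $$ (Suc i, Suc j) - A $$ (i, Suc j) = A $$ (Suc i, j) - A $$ (i, j)"
      using that by (intro smooth11_step \<open>smooth11 A\<close>) auto
    then have "D (j + q) = D j"
      using row_diff[of j] row_diff[of "Suc j"] that sum_window_shift[of D j q] by simp
    then show ?thesis by (simp add: D)
  qed
  have "M $$ (i + p, j) - M $$ (i, j) = M $$ (i + p, j mod q) - M $$ (i, j mod q)"
    if "i + p < m" for i
    using eq_on_residue_class[of q n "\<lambda>j. M $$ (i + p, j) - M $$ (i, j)"] chi that ij(2) by blast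
  then have "M $$ (i, j) - M $$ (i, j mod q) = M $$ (i mod p, j) - M $$ (i mod p, j mod q)"
    using eq_on_residue_class[of p m "\<lambda>i. M $$ (i, j) - M $$ (i, j mod q)" i] ij(1) by force
  then show ?thesis by simp
qed

text \<open>The predicates \<open>Q\<close>, \<open>P\<close> and \<open>C\<close> stand for the residue classes of a solution on which it varies
  with the row, varies with the column, or is constantly 1; \<open>e\<close> and \<open>f\<close> are the excesses of its
  row and column counts over \<open>xr\<close> and \<open>xc\<close>. Among the positions of type \<open>Q\<close> in row \<open>a\<close>, the class
  maximum keeps the symbol, \<open>e a\<close> become ones, and the rest become zeros; columns are treated
  alike. No conflict arises since no position has two types.\<close>

lemma admissible_exists:
  assumes excl: "\<And>a b. \<not> (Q a b \<and> P a b)" "\<And>a b. C a b \<Longrightarrow> \<not> Q a b \<and> \<not> P a b"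
    and row: "\<And>a. a < p \<Longrightarrow> 0 \<le> class_max p xr a \<and> 0 \<le> e a \<and>
      class_max p xr a + e a \<le> int (card {b. b < q \<and> Q a b})"
    and col: "\<And>b. b < q \<Longrightarrow> 0 \<le> class_max q xc b \<and> 0 \<le> f b \<and>
      class_max q xc b + f b \<le> int (card {a. a < p \<and> P a b})"
    and k: "k = (\<Sum>a = 0..<p. e a) + (\<Sum>b = 0..<q. f b)
      + (\<Sum>a = 0..<p. \<Sum>b = 0..<q. of_bool (C a b))"
  shows "\<exists>W. admissible p q xr xc k W"
proof -
  obtain U V where UV: "\<And>a. a < p \<Longrightarrow> U a \<subseteq> {b. b < q \<and> Q a b}"
    "\<And>a. a < p \<Longrightarrow> V a \<subseteq> {b. b < q \<and> Q a b}" "\<And>a. a < p \<Longrightarrow> U a \<inter> V a = {}"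
    "\<And>a. a < p \<Longrightarrow> int (card (U a)) = class_max p xr a" "\<And>a. a < p \<Longrightarrow> int (card (V a)) = e a"
    by (rule disjoint_subset_families[of p "\<lambda>a. {b. b < q \<and> Q a b}" "class_max p xr" e])
      (use row in auto)
  obtain X Y where XY: "\<And>b. b < q \<Longrightarrow> X b \<subseteq> {a. a < p \<and> P a b}"
    "\<And>b. b < q \<Longrightarrow> Y b \<subseteq> {a. a < p \<and> P a b}" "\<And>b. b < q \<Longrightarrow> X b \<inter> Y b = {}"
    "\<And>b. b < q \<Longrightarrow> int (card (X b)) = class_max q xc b" "\<And>b. b < q \<Longrightarrow> int (card (Y b)) = f b"
    by (rule disjoint_subset_families[of q "\<lambda>b. {a. a < p \<and> P a b}" "class_max q xc" f])
      (use col in auto)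
  define W where "W = mat p q (\<lambda>(a, b). if b \<in> U a then SymQ else if a \<in> X b then SymP
    else if b \<in> V a \<or> a \<in> Y b \<or> C a b then SymOne else SymZero)"
  have Q: "Q a b" if "a < p" "b \<in> U a \<or> b \<in> V a" for a b
    using UV(1,2)[OF that(1)] that(2) by blast
  have P: "P a b" if "b < q" "a \<in> X b \<or> a \<in> Y b" for a b
    using XY(1,2)[OF that(1)] that(2) by blast
  have W: "W $$ (a, b) = (if b \<in> U a then SymQ else if a \<in> X b then SymP
    else if b \<in> V a \<or> a \<in> Y b \<or> C a b then SymOne else SymZero)" if "a < p" "b < q" for a b
    using that by (simp add: W_def)
  have "{b. b < q \<and> W $$ (a, b) = SymQ} = U a" if "a < p" for a
    using UV(1)[OF that] that by (auto simp: W split: if_splits)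
  moreover have "{a. a < p \<and> W $$ (a, b) = SymP} = X b" if "b < q" for b
  proof -
    have "W $$ (a, b) = SymP \<longleftrightarrow> a \<in> X b" if "a < p" for a
      using Q[OF \<open>a < p\<close>, of b] P[OF \<open>b < q\<close>, of a] excl(1)[of a b] that \<open>b < q\<close> by (auto simp: W)
    then show ?thesis using XY(1)[OF that] by auto
  qed
  moreover have "int (card {(a, b). a < p \<and> b < q \<and> W $$ (a, b) = SymOne}) = k"
  proof -
    have ones: "of_bool (W $$ (a, b) = SymOne) =
        of_bool (b \<in> V a) + of_bool (a \<in> Y b) + (of_bool (C a b) :: int)"
      if "a < p" "b < q" for a b
      using Q[OF that(1), of b] P[OF that(2), of a] UV(3)[OF that(1)] XY(3)[OF that(2)]
        excl[of a b] by (auto simp: W[OF that])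
    have "int (card {(a, b). a < p \<and> b < q \<and> W $$ (a, b) = SymOne}) =
        (\<Sum>a = 0..<p. \<Sum>b = 0..<q. of_bool (W $$ (a, b) = SymOne))"
      by (rule sum_of_bool_pairs[symmetric])
    also have "\<dots> = (\<Sum>a = 0..<p. \<Sum>b = 0..<q.
        of_bool (b \<in> V a) + of_bool (a \<in> Y b) + of_bool (C a b))"
      using ones by (intro sum.cong refl) auto
    also have "\<dots> = (\<Sum>a = 0..<p. \<Sum>b = 0..<q. of_bool (b \<in> V a))
        + (\<Sum>b = 0..<q. \<Sum>a = 0..<p. of_bool (a \<in> Y b))
        + (\<Sum>a = 0..<p. \<Sum>b = 0..<q. of_bool (C a b))"
      unfolding sum.distrib
      by (simp only: sum.swap[of "\<lambda>a b. of_bool (a \<in> Y b)" "{0..<q}"])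
    also have "(\<Sum>a = 0..<p. \<Sum>b = 0..<q. of_bool (b \<in> V a)) = (\<Sum>a = 0..<p. e a)"
    proof (intro sum.cong refl)
      fix a assume "a \<in> {0..<p}"
      then have "{0..<q} \<inter> {b. b \<in> V a} = V a" "int (card (V a)) = e a"
        using UV(2,5)[of a] by auto
      then show "(\<Sum>b = 0..<q. of_bool (b \<in> V a)) = e a" by (simp add: sum_of_bool_eq)
    qed
    also have "(\<Sum>b = 0..<q. \<Sum>a = 0..<p. of_bool (a \<in> Y b)) = (\<Sum>b = 0..<q. f b)"
    proof (intro sum.cong refl)
      fix b assume "b \<in> {0..<q}"
      then have "{0..<p} \<inter> {a. a \<in> Y b} = Y b" "int (card (Y b)) = f b"
        using XY(2,5)[of b] by auto
      then show "(\<Sum>a = 0..<p. of_bool (a \<in> Y b)) = f b" by (simp add: sum_of_bool_eq)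
    qed
    finally show ?thesis using k by simp
  qed
  ultimately have "admissible p q xr xc k W"
    using UV(4) XY(4) unfolding admissible_def by (simp add: W_def)
  then show ?thesis ..
qed

text \<open>Bounds \<open>x ! l + e \<le> g\<close> with \<open>e\<close> and \<open>g\<close> constant on classes pass to the class maximum,
  because it is attained.\<close>

lemma class_max_bound:
  assumes "\<And>l. l < length x \<Longrightarrow> 0 \<le> x ! l \<and> x ! l + e (l mod p) \<le> g (l mod p)"
    and "a < p" and "p \<le> length x"
  shows "0 \<le> class_max p x a \<and> class_max p x a + e a \<le> g a"
proof -
  obtain l where "l < length x" "l mod p = a mod p" "class_max p x a = x ! l"
    using class_max_attained[of a x p] assms(2,3) by auto
  then show ?thesis using assms(1)[of l] \<open>a < p\<close> by simp
qed

lemma binary_mat_entry: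
  assumes "binary_mat M" and "i < dim_row M" and "j < dim_col M"
  shows "M $$ (i, j) = 0 \<or> M $$ (i, j) = 1"
proof -
  have "M $$ (i, j) \<in> elements_mat M"
    using assms(2,3) by auto
  then show ?thesis using assms(1) by (auto simp: binary_mat_def)
qed

text \<open>The shift \<open>t\<close> is arbitrary here: it moves a constant from the column part to the row part, which
  changes neither the computed vectors nor the sum of the two residuals.\<close>

lemma rec_smooth_try_complete:
  assumes "p \<ge> 1" and "q \<ge> 1" and "m' \<ge> 1" and "n' \<ge> 1"
    and A: "A \<in> carrier_mat m' n'" and "smooth11 A"
    and M: "M \<in> carrier_mat (m' + p - 1) (n' + q - 1)" and "binary_mat M"
    and scan: "rect_scan p q M = A"
  shows "rec_smooth_try A p q t \<noteq> None"
proof -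
  define m n where "m = m' + p - 1" and "n = n' + q - 1"
  have pm: "p \<le> m" "q \<le> n" using assms by (auto simp: m_def n_def)
  have binary: "M $$ (i, j) = 0 \<or> M $$ (i, j) = 1" if "i < m" "j < n" for i j
    using binary_mat_entry[OF \<open>binary_mat M\<close>] M that by (simp add: m_def n_def)
  have grid: "M $$ (i, j) = M $$ (i, j mod q) + M $$ (i mod p, j) - M $$ (i mod p, j mod q)"
    if "i < m" "j < n" for i j
    using smooth_scan_grid[OF M scan \<open>smooth11 A\<close>, folded m_def n_def, OF pm that] .
  define Q where "Q a b \<longleftrightarrow> a < p \<and> b < q \<and> (\<exists>i<m. i mod p = a \<and> M $$ (i, b) \<noteq> M $$ (a, b))" for a b
  define P where "P a b \<longleftrightarrow> a < p \<and> b < q \<and> (\<exists>j<n. j mod q = b \<and> M $$ (a, j) \<noteq> M $$ (a, b))" for a b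
  define C where "C a b \<longleftrightarrow> \<not> Q a b \<and> \<not> P a b \<and> M $$ (a, b) = 1" for a b
  \<comment> \<open>A class varying in both directions would contain a value outside \<open>{0, 1}\<close>: adding two changes
    away from 0 gives 2, and away from 1 gives - 1.\<close>
  have excl: "\<not> (Q a b \<and> P a b)" for a b
  proof
    assume "Q a b \<and> P a b"
    then obtain i j where "a < p" "b < q" "i < m" "j < n" and *: "i mod p = a" "j mod q = b"
      "M $$ (i, b) \<noteq> M $$ (a, b)" "M $$ (a, j) \<noteq> M $$ (a, b)"
      by (auto simp: Q_def P_def)
    then show False
      using grid[of i j] binary[of i j] binary[of a b] binary[of i b] binary[of a j] pm by auto
  qed
  define u where "u i b = (if Q (i mod p) b then M $$ (i, b) else 0)" for i b
  define v where "v a j = (if P a (j mod q) then M $$ (a, j) else 0)" for a j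
  define y where "y i = (\<Sum>b = 0..<q. u i b)" for i
  define z where "z j = (\<Sum>a = 0..<p. v a j)" for j
  define K :: int where "K = (\<Sum>a = 0..<p. \<Sum>b = 0..<q. of_bool (C a b))"
  have split: "M $$ (i, j) = u i (j mod q) + v (i mod p) j + of_bool (C (i mod p) (j mod q))"
    if "i < m" "j < n" for i j
  proof -
    have "i mod p < p" "j mod q < q" using \<open>p \<ge> 1\<close> \<open>q \<ge> 1\<close> by auto
    moreover from this have "M $$ (i, j mod q) = M $$ (i mod p, j mod q)"
      if "\<not> Q (i mod p) (j mod q)"
      using that \<open>i < m\<close> by (auto simp: Q_def)
    moreover have "M $$ (i mod p, j) = M $$ (i mod p, j mod q)"
      if "\<not> P (i mod p) (j mod q)"
      using that \<open>j < n\<close> calculation(1,2) by (auto simp: P_def)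
    ultimately show ?thesis
      using grid[OF that] excl[of "i mod p" "j mod q"] binary[of "i mod p" "j mod q"] pm
      by (auto simp: u_def v_def C_def)
  qed
  have A_sum: "A $$ (i, j) = (\<Sum>r = 0..<p. y (i + r)) + (\<Sum>c = 0..<q. z (j + c)) + K"
    if "i < m'" "j < n'" for i j
  proof -
    have "A $$ (i, j) = (\<Sum>r = 0..<p. \<Sum>c = 0..<q. M $$ (i + r, j + c))"
      using M that assms(1-4) unfolding scan[symmetric] by (auto simp: rect_scan_def)
    also have "\<dots> = (\<Sum>r = 0..<p. y (i + r)) + (\<Sum>c = 0..<q. z (j + c)) + K"
      unfolding y_def z_def K_def using split
    proof (rule window_sum_separated[of m n])
      show "i + p \<le> m" "j + q \<le> n" using that by (simp_all add: m_def n_def)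
    qed
    finally show ?thesis .
  qed
  have y_bounds: "0 \<le> y i" "y i \<le> int (card {b. b < q \<and> Q (i mod p) b})" if "i < m" for i
  proof -
    have *: "0 \<le> u i b \<and> u i b \<le> of_bool (Q (i mod p) b)" if "b < q" for b
      using binary[of i b] \<open>i < m\<close> that pm by (auto simp: u_def)
    then show "0 \<le> y i" unfolding y_def by (intro sum_nonneg) auto
    have "y i \<le> (\<Sum>b = 0..<q. of_bool (Q (i mod p) b))"
      unfolding y_def using * by (intro sum_mono) auto
    also have "{0..<q} \<inter> {b. Q (i mod p) b} = {b. b < q \<and> Q (i mod p) b}" by auto
    then have "(\<Sum>b = 0..<q. of_bool (Q (i mod p) b)) = int (card {b. b < q \<and> Q (i mod p) b})"
      by (simp add: sum_of_bool_eq)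
    finally show "y i \<le> int (card {b. b < q \<and> Q (i mod p) b})" .
  qed
  have z_bounds: "0 \<le> z j" "z j \<le> int (card {a. a < p \<and> P a (j mod q)})" if "j < n" for j
  proof -
    have *: "0 \<le> v a j \<and> v a j \<le> of_bool (P a (j mod q))" if "a < p" for a
      using binary[of a j] \<open>j < n\<close> that pm by (auto simp: v_def)
    then show "0 \<le> z j" unfolding z_def by (intro sum_nonneg) auto
    have "z j \<le> (\<Sum>a = 0..<p. of_bool (P a (j mod q)))"
      unfolding z_def using * by (intro sum_mono) auto
    also have "{0..<p} \<inter> {a. P a (j mod q)} = {a. a < p \<and> P a (j mod q)}" by auto
    then have "(\<Sum>a = 0..<p. of_bool (P a (j mod q))) = int (card {a. a < p \<and> P a (j mod q)})"
      by (simp add: sum_of_bool_eq)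
    finally show "z j \<le> int (card {a. a < p \<and> P a (j mod q)})" .
  qed
  \<comment> \<open>The marks in one row or column are therefore few enough for the failure tests of the loop.\<close>
  have card_le: "card {b. b < k \<and> R b} \<le> k" for k and R :: "nat \<Rightarrow> bool"
    using card_mono[of "{..<k}" "{b. b < k \<and> R b}"] by auto
  have y_q: "0 \<le> y i \<and> y i \<le> int q" if "i < m" for i
    using y_bounds[OF that] card_le[of q "Q (i mod p)"] by linarith
  have z_p: "0 \<le> z j \<and> z j \<le> int p" if "j < n" for j
    using z_bounds[OF that] card_le[of p "\<lambda>a. P a (j mod q)"] by linarith
  define Y0 Z0 where "Y0 = (\<Sum>r = 0..<p. y r)" and "Z0 = (\<Sum>c = 0..<q. z c)"
  have A00: "A $$ (0, 0) = Y0 + Z0 + K"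
    using A_sum[of 0 0] assms by (simp add: Y0_def Z0_def)
  have dims: "dim_row (row_part A t) = m'" "dim_row (transpose_mat (col_part A t)) = n'"
    using A by (auto simp: row_part_def col_part_def)
  have y_sum: "(\<Sum>r = 0..<p. y (i + r)) = row_part A t $$ (i, 0) + (Y0 - rho A 0 - t)"
    if "i < m'" for i
    using A_sum[of i 0] A00 that A assms(4) rho_smooth[OF \<open>smooth11 A\<close>, of i]
    by (simp add: row_part_def Z0_def)
  have z_sum: "(\<Sum>c = 0..<q. z (j + c)) =
      transpose_mat (col_part A t) $$ (j, 0) + (rho A 0 + t - Y0 - K)" if "j < n'" for j
    using A_sum[of 0 j] that A assms(3) by (simp add: col_part_def Y0_def)
  have "\<exists>x k e. rec_const_rows_step1 (row_part A t) p q = Some (x, k) \<and> (\<forall>a. 0 \<le> e a) \<and>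
      (\<forall>l < m. y l = x ! l + e (l mod p)) \<and> k + (Y0 - rho A 0 - t) = (\<Sum>a = 0..<p. e a)"
    using \<open>p \<ge> 1\<close> \<open>m' \<ge> 1\<close> y_q y_sum
    by (rule rec_const_rows_step1_complete[of p "row_part A t" y q "Y0 - rho A 0 - t",
          unfolded dims, folded m_def])
  then obtain xr kr e where row: "rec_const_rows_step1 (row_part A t) p q = Some (xr, kr)"
    and e: "\<And>a. 0 \<le> e a" "\<And>l. l < m \<Longrightarrow> y l = xr ! l + e (l mod p)"
      "kr + (Y0 - rho A 0 - t) = (\<Sum>a = 0..<p. e a)"
    by blast
  have "\<exists>x k f. rec_const_rows_step1 (transpose_mat (col_part A t)) q p = Some (x, k) \<and>
      (\<forall>b. 0 \<le> f b) \<and> (\<forall>l < n. z l = x ! l + f (l mod q)) \<and>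
      k + (rho A 0 + t - Y0 - K) = (\<Sum>b = 0..<q. f b)"
    using \<open>q \<ge> 1\<close> \<open>n' \<ge> 1\<close> z_p z_sum
    by (rule rec_const_rows_step1_complete[of q "transpose_mat (col_part A t)" z p
          "rho A 0 + t - Y0 - K", unfolded dims, folded n_def])
  then obtain xc kc f
    where col: "rec_const_rows_step1 (transpose_mat (col_part A t)) q p = Some (xc, kc)"
    and f: "\<And>b. 0 \<le> f b" "\<And>l. l < n \<Longrightarrow> z l = xc ! l + f (l mod q)"
      "kc + (rho A 0 + t - Y0 - K) = (\<Sum>b = 0..<q. f b)"
    by blast
  note r = rec_const_rows_step1_sound[OF row \<open>p \<ge> 1\<close>, unfolded dims, OF \<open>m' \<ge> 1\<close>, folded m_def]
  note c = rec_const_rows_step1_sound[OF col \<open>q \<ge> 1\<close>, unfolded dims, OF \<open>n' \<ge> 1\<close>, folded n_def]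
  have "\<exists>W. admissible p q xr xc (kr + kc) W"
  proof (rule admissible_exists[of Q P C p xr e q xc f])
    fix a assume "a < p"
    have "0 \<le> class_max p xr a \<and> class_max p xr a + e a \<le> int (card {b. b < q \<and> Q a b})"
      using r e y_bounds pm \<open>a < p\<close> by (intro class_max_bound) auto
    then show "0 \<le> class_max p xr a \<and> 0 \<le> e a \<and>
        class_max p xr a + e a \<le> int (card {b. b < q \<and> Q a b})"
      using e(1) by blast
  next
    fix b assume "b < q"
    have "0 \<le> class_max q xc b \<and> class_max q xc b + f b \<le> int (card {a. a < p \<and> P a b})"
      using c f z_bounds pm \<open>b < q\<close> by (intro class_max_bound) auto
    then show "0 \<le> class_max q xc b \<and> 0 \<le> f b \<and>
        class_max q xc b + f b \<le> int (card {a. a < p \<and> P a b})"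
      using f(1) by blast
  next
    \<comment> \<open>The two shifts relating \<open>y\<close> and \<open>z\<close> to the row and column parts add up to \<open>- K\<close>.\<close>
    show "kr + kc = (\<Sum>a = 0..<p. e a) + (\<Sum>b = 0..<q. f b)
        + (\<Sum>a = 0..<p. \<Sum>b = 0..<q. of_bool (C a b))"
      using e(3) f(3) unfolding K_def by linarith
  qed (use excl in \<open>auto simp: C_def\<close>)
  then show ?thesis
    using row col by (simp add: rec_smooth_try_def rec_const_cols_step1_def)
qed

text \<open>Ensures that the range of shifts tried by the search contains 0.\<close>

lemma rect_scan_min_entry_nonneg:
  assumes "binary_mat M" and "p \<le> dim_row M" and "q \<le> dim_col M"
  shows "0 \<le> min_entry (rect_scan p q M)"
proof -
  let ?A = "rect_scan p q M"
  have "0 \<le> ?A $$ (i, j)" if "i < dim_row ?A" "j < dim_col ?A" for i j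
  proof -
    have "0 \<le> M $$ (i + r, j + c)" if "r < p" "c < q" for r c
    proof -
      have "i + r < dim_row M" "j + c < dim_col M"
        using that \<open>i < dim_row ?A\<close> \<open>j < dim_col ?A\<close> assms(2,3) by (simp_all add: rect_scan_def)
      then show ?thesis
        using binary_mat_entry[OF \<open>binary_mat M\<close>] by fastforce
    qed
    then show ?thesis
      using that by (auto simp: rect_scan_def intro!: sum_nonneg)
  qed
  moreover have "finite (elements_mat ?A)" "elements_mat ?A \<noteq> {}"
    by (auto simp: elements_mat_def rect_scan_def)
  ultimately show ?thesis
    unfolding min_entry_def by (auto simp: elements_mat_def)
qed

theorem theorem16:
  fixes p q m' n' m n :: nat and A :: "int mat"
  assumes "p \<ge> 1" and "q \<ge> 1" and "m' \<ge> 1" and "n' \<ge> 1"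
    and "m = m' + p - 1" and "n = n' + q - 1"
    and "A \<in> carrier_mat m' n'"
    and "smooth11 A"
  shows "(\<exists>M \<in> carrier_mat m n. binary_mat M \<and> rect_scan p q M = A)
    \<longleftrightarrow> rec_smooth A p q \<noteq> None"
proof
  assume "\<exists>M \<in> carrier_mat m n. binary_mat M \<and> rect_scan p q M = A"
  then obtain M where M: "M \<in> carrier_mat m n" "binary_mat M" "rect_scan p q M = A" by blast
  then have "0 \<le> min_entry A"
    using rect_scan_min_entry_nonneg[of M p q] assms by auto
  moreover have "rec_smooth_try A p q 0 \<noteq> None"
    using rec_smooth_try_complete[of p q m' n' A M 0] M assms by blast
  ultimately have "find (\<lambda>t. rec_smooth_try A p q t \<noteq> None) [0..min_entry A] \<noteq> None"
    by (auto simp: find_None_iff)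
  then obtain t where t: "find (\<lambda>t. rec_smooth_try A p q t \<noteq> None) [0..min_entry A] = Some t"
    by blast
  then have "rec_smooth_try A p q t \<noteq> None"
    unfolding find_Some_iff by blast
  then show "rec_smooth A p q \<noteq> None"
    using t by (simp add: rec_smooth_def)
next
  assume "rec_smooth A p q \<noteq> None"
  then obtain M where "rec_smooth A p q = Some M" by blast
  then obtain t where "rec_smooth_try A p q t = Some M"
    by (auto simp: rec_smooth_def bind_eq_Some_conv)
  then show "\<exists>M \<in> carrier_mat m n. binary_mat M \<and> rect_scan p q M = A"
    using rec_smooth_try_sound[of p q m' n' A t M] assms by blast
qed

end
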